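(* Assume $h=0$. Then $\vartheta_{\mathrm{dual}}^{\mathrm{relax}}<\infty$, i.e. the relaxation $$\begin{aligned} \vartheta_{\mathrm{dual}}^{\mathrm{relax}}=\max\ &-y^\top\mathcal Ry-r^\top y-\overline w_{\leftrightarrow}^\top\theta^w_{\leftrightarrow}-\overline y_{\leftrightarrow}^\top\theta^y_{\leftrightarrow}-h^\top\pi-c_x^\top x-c_z^\top z\\ \text{s.t. }&(z,x)\in\overline{\mathcal P},\ 0\le z\le\overline z,\ 0\le x\le\overline x,\ \pi\ge0,\\ &Gy+Hw=h+\begin{pmatrix} x \\ 0 \end{pmatrix},\ \ \mathcal Ry+G^\top\pi-\mu^y+I^y_{\leftrightarrow}\theta^y_{\leftrightarrow}=-r,\ \ H^\top\pi-\mu^w+I^w_{\leftrightarrow}\theta^w_{\leftrightarrow}=0,\\ &y\ge0,\ w\ge0,\ y_{\leftrightarrow}\le\overline y_{\leftrightarrow},\ w_{\leftrightarrow}\le\overline w_{\leftrightarrow},\ \mu\ge0,\ \theta^y_{\leftrightarrow}\ge0,\ \theta^w_{\leftrightarrow}\ge0 \end{aligned}$$ (maximization over $z,x,y,w,\pi,\mu=(\mu^y,\mu^w),\theta^y_{\leftrightarrow},\theta^w_{\leftrightarrow}$) has a bounded optimal value.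
   Context: Leader. $\overline{\mathcal P}\subseteq\mathbb R^{d_z+d_x}$ is closed and convex; $\overline z,\overline x$ are finite; $c_z,c_x$ are given cost vectors. Follower. For a given $x$, the follower feasible set $\mathcal Y(x)$ is the set of $(y,w)\in\mathbb R^{d_y+d_w}$ with $G_0y+H_0w-x=h_0$, $G_1y+H_1w=h_1$, $0\le y\le\overline y$, $0\le w\le\overline w$, where components of $\overline y,\overline w$ may be $+\infty$. Write $G=\begin{pmatrix} G_0 \\ G_1 \end{pmatrix}$, $H=\begin{pmatrix} H_0 \\ H_1 \end{pmatrix}$, $h=\begin{pmatrix} h_0 \\ h_1 \end{pmatrix}$. The follower cost vector is affine, $\Phi(y)=\mathcal Ry+r$, with $\mathcal R$ a symmetric positive definite matrix. Dual variables: $\pi=(\pi_0,\pi_1)$ for the equalities, $\mu=(\mu^y,\mu^w)$ for $y\ge0$, $w\ge0$, and $\theta^y_{\leftrightarrow},\theta^w_{\leftrightarrow}$ for the finite upper bounds. Notation. $I^y,I^w$ are identity matrices of dimensions $d_y,d_w$. For a matrix $M$ with $d_y$ columns, $M_{\leftrightarrow}$ is the submatrix of the columns whose indices do not belong to $\{i:\overline y_i=\infty\}$; for matrices with $d_w$ columns the same is done with $\{i:\overline w_i=\infty\}$. Vectors in $\mathbb R^{d_y}$ or $\mathbb R^{d_w}$ are restricted similarly to subvectors $v_{\leftrightarrow}$. Standing assumption: for every feasible leader decision $x$ there is $(y^*,w^* )\in\mathcal Y(x)$ with $\langle\Phi(y^* ),y'-y^*\rangle\ge0$ for all $y'\in\mathrm{proj}_y\mathcal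 Y(x)$. The optimal value is understood as a supremum in $[-\infty,+\infty]$; "bounded optimal value" means that this supremum is $<+\infty$. *)

theory Defs
  imports "HOL-Analysis.Analysis"
begin

text \<open>Block column of two vectors. Since a matrix is a vector of rows, this also stacks
  matrices on top of each other.\<close>

definition stack :: "'a ^ 'm \<Rightarrow> 'a ^ 'n \<Rightarrow> 'a ^ ('m::finite + 'n::finite)" where
  "stack u v = (\<chi> i. case i of Inl j \<Rightarrow> u $ j | Inr k \<Rightarrow> v $ k)"

definition pos_def :: "real ^ 'n ^ 'n \<Rightarrow> bool" where
  "pos_def M \<longleftrightarrow> (\<forall>v. v \<noteq> 0 \<longrightarrow> v \<bullet> (M *v v) > 0)"

definition bounded_idx :: "ereal ^ 'n \<Rightarrow> 'n set" where
  "bounded_idx u = {i. u $ i \<noteq> \<infinity>}"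

text \<open>The index set \<open>J = bounded_idx u\<close> depends on data and hence is not a type. A subvector
  indexed by \<open>J\<close> is represented by its extension by zero to all indices, and
  products with such a subvector sum over \<open>J\<close> only.\<close>

definition subvectors :: "'n set \<Rightarrow> (real ^ 'n) set" where
  "subvectors J = {v. \<forall>i. i \<notin> J \<longrightarrow> v $ i = 0}"

definition cols_mult :: "real ^ 'n ^ 'm \<Rightarrow> 'n set \<Rightarrow> real ^ 'n \<Rightarrow> real ^ 'm" where
  "cols_mult M J v = (\<chi> i. \<Sum>j\<in>J. M $ i $ j * v $ j)"

definition leader_set ::
  "((real ^ 'z) \<times> (real ^ 'x)) set \<Rightarrow> real ^ 'z \<Rightarrow> real ^ 'x \<Rightarrow> ((real ^ 'z) \<times> (real ^ 'x)) set" where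
  "leader_set P zbar xbar = {(z, x). (z, x) \<in> P \<and> 0 \<le> z \<and> z \<le> zbar \<and> 0 \<le> x \<and> x \<le> xbar}"

definition follower_set ::
  "real ^ 'y ^ 'x \<Rightarrow> real ^ 'w ^ 'x \<Rightarrow> real ^ 'x \<Rightarrow>
   real ^ 'y ^ 'm \<Rightarrow> real ^ 'w ^ 'm \<Rightarrow> real ^ 'm \<Rightarrow>
   ereal ^ 'y \<Rightarrow> ereal ^ 'w \<Rightarrow> real ^ 'x \<Rightarrow> ((real ^ 'y) \<times> (real ^ 'w)) set" where
  "follower_set G0 H0 h0 G1 H1 h1 ybar wbar x =
    {(y, w). G0 *v y + H0 *v w - x = h0 \<and> G1 *v y + H1 *v w = h1 \<and>
       0 \<le> y \<and> (\<forall>i. ereal (y $ i) \<le> ybar $ i) \<and>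
       0 \<le> w \<and> (\<forall>i. ereal (w $ i) \<le> wbar $ i)}"

definition follower_cost :: "real ^ 'y ^ 'y \<Rightarrow> real ^ 'y \<Rightarrow> real ^ 'y \<Rightarrow> real ^ 'y" where
  "follower_cost R r y = R *v y + r"

definition vi_solvable ::
  "real ^ 'y ^ 'y \<Rightarrow> real ^ 'y \<Rightarrow> ((real ^ 'y) \<times> (real ^ 'w)) set \<Rightarrow> bool" where
  "vi_solvable R r Y \<longleftrightarrow>
    (\<exists>(y, w) \<in> Y. \<forall>y' \<in> fst ` Y. follower_cost R r y \<bullet> (y' - y) \<ge> 0)"

definition dual_relax_feasible ::
  "((real ^ 'z) \<times> (real ^ 'x)) set \<Rightarrow> real ^ 'z \<Rightarrow> real ^ 'x \<Rightarrow>
   real ^ 'y ^ ('x::finite + 'm::finite) \<Rightarrow> real ^ 'w ^ ('x::finite + 'm::finite) \<Rightarrow> real ^ ('x::finite + 'm::finite) \<Rightarrow>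
   ereal ^ 'y \<Rightarrow> ereal ^ 'w \<Rightarrow> real ^ 'y ^ 'y \<Rightarrow> real ^ 'y \<Rightarrow>
   ((real ^ 'z) \<times> (real ^ 'x) \<times> (real ^ 'y) \<times> (real ^ 'w) \<times> (real ^ ('x::finite + 'm::finite)) \<times>
    ((real ^ 'y) \<times> (real ^ 'w)) \<times> (real ^ 'y) \<times> (real ^ 'w)) set" where
  "dual_relax_feasible P zbar xbar G H h ybar wbar R r =
    {(z, x, y, w, \<pi>, (\<mu>y, \<mu>w), \<theta>y, \<theta>w).
       (z, x) \<in> leader_set P zbar xbar \<and> 0 \<le> \<pi> \<and>
       G *v y + H *v w = h + stack x 0 \<and>
       R *v y + transpose G *v \<pi> - \<mu>y + cols_mult (mat 1) (bounded_idx ybar) \<theta>y = - r \<and>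
       transpose H *v \<pi> - \<mu>w + cols_mult (mat 1) (bounded_idx wbar) \<theta>w = 0 \<and>
       0 \<le> y \<and> 0 \<le> w \<and>
       (\<forall>i \<in> bounded_idx ybar. ereal (y $ i) \<le> ybar $ i) \<and>
       (\<forall>i \<in> bounded_idx wbar. ereal (w $ i) \<le> wbar $ i) \<and>
       0 \<le> \<mu>y \<and> 0 \<le> \<mu>w \<and>
       \<theta>y \<in> subvectors (bounded_idx ybar) \<and> 0 \<le> \<theta>y \<and>
       \<theta>w \<in> subvectors (bounded_idx wbar) \<and> 0 \<le> \<theta>w}"

text \<open>On \<open>bounded_idx u\<close> the entries of \<open>u\<close> are real (bounds are never \<open>-\<infinity>\<close>), so
  \<open>real_of_ereal\<close> only strips the type there.\<close>

definition dual_relax_objective ::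
  "real ^ 'z \<Rightarrow> real ^ 'x \<Rightarrow> real ^ ('x::finite + 'm::finite) \<Rightarrow>
   ereal ^ 'y \<Rightarrow> ereal ^ 'w \<Rightarrow> real ^ 'y ^ 'y \<Rightarrow> real ^ 'y \<Rightarrow>
   (real ^ 'z) \<times> (real ^ 'x) \<times> (real ^ 'y) \<times> (real ^ 'w) \<times> (real ^ ('x::finite + 'm::finite)) \<times>
    ((real ^ 'y) \<times> (real ^ 'w)) \<times> (real ^ 'y) \<times> (real ^ 'w) \<Rightarrow> real" where
  "dual_relax_objective cz cx h ybar wbar R r =
    (\<lambda>(z, x, y, w, \<pi>, (\<mu>y, \<mu>w), \<theta>y, \<theta>w).
       - (y \<bullet> (R *v y)) - r \<bullet> y
       - (\<Sum>i \<in> bounded_idx wbar. real_of_ereal (wbar $ i) * \<theta>w $ i)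
       - (\<Sum>i \<in> bounded_idx ybar. real_of_ereal (ybar $ i) * \<theta>y $ i)
       - h \<bullet> \<pi> - cx \<bullet> x - cz \<bullet> z)"

text \<open>As a supremum in \<open>ereal\<close>, the value is \<open>-\<infinity>\<close> if the problem is infeasible.\<close>

definition dual_relax_value ::
  "((real ^ 'z) \<times> (real ^ 'x)) set \<Rightarrow> real ^ 'z \<Rightarrow> real ^ 'x \<Rightarrow> real ^ 'z \<Rightarrow> real ^ 'x \<Rightarrow>
   real ^ 'y ^ ('x::finite + 'm::finite) \<Rightarrow> real ^ 'w ^ ('x::finite + 'm::finite) \<Rightarrow> real ^ ('x::finite + 'm::finite) \<Rightarrow>
   ereal ^ 'y \<Rightarrow> ereal ^ 'w \<Rightarrow> real ^ 'y ^ 'y \<Rightarrow> real ^ 'y \<Rightarrow> ereal" where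
  "dual_relax_value P zbar xbar cz cx G H h ybar wbar R r =
    (SUP s \<in> dual_relax_feasible P zbar xbar G H h ybar wbar R r.
       ereal (dual_relax_objective cz cx h ybar wbar R r s))"

end

theory Submission
  imports Defs
begin

text \<open>With \<open>h = 0\<close> the dual multipliers occur in the objective only through the terms
  for the finite upper bounds. As soon as there is a feasible point, \<open>0 \<le> y\<^sub>i \<le> ybar\<^sub>i\<close> and
  \<open>0 \<le> w\<^sub>i \<le> wbar\<^sub>i\<close> force these bounds to be nonnegative, and the multipliers are nonnegative
  as well; so these terms can only lower the objective, however large the multipliers become.
  What remains is a concave quadratic in \<open>y\<close>, bounded above by completing the square
  (\<open>concave_quadratic_bounded_above\<close>), and a linear function of \<open>(z, x)\<close> on a box
  (\<open>neg_inner_le_on_box\<close>). The bounds of these two pieces do not depend on the feasible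
  point, hence their sum bounds the supremum.\<close>

lemma pos_def_imp_surj:
  fixes R :: "real ^ 'n ^ 'n"
  assumes "pos_def R"
  shows "surj ((*v) R)"
proof -
  have "inj ((*v) R)"
  proof (rule injI)
    fix u v
    assume "R *v u = R *v v"
    then have "(u - v) \<bullet> (R *v (u - v)) = 0"
      by (simp add: matrix_vector_mult_diff_distrib)
    then show "u = v"
      using assms unfolding pos_def_def by (metis eq_iff_diff_eq_0 less_irrefl)
  qed
  then show ?thesis
    by (simp add: linear_injective_imp_surjective)
qed

text \<open>Choose \<open>v\<close> with \<open>2 R v = r\<close>. By symmetry,
  \<open>y\<^sup>T R y + r\<^sup>T y = (y + v)\<^sup>T R (y + v) - v\<^sup>T R v \<ge> - v\<^sup>T R v\<close>.\<close>

lemma concave_quadratic_bounded_above: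
  fixes R :: "real ^ 'n ^ 'n"
  assumes sym: "transpose R = R" and pd: "pos_def R"
  shows "\<exists>B. \<forall>y. - (y \<bullet> (R *v y)) - r \<bullet> y \<le> B"
proof -
  obtain v where v: "R *v v = (1/2) *\<^sub>R r"
    using pos_def_imp_surj[OF pd] by (metis surjD)
  have "- (y \<bullet> (R *v y)) - r \<bullet> y \<le> v \<bullet> (R *v v)" for y
  proof -
    have "v \<bullet> (R *v y) = (R *v v) \<bullet> y"
      by (metis dot_lmul_matrix sym transpose_matrix_vector)
    then have "v \<bullet> (R *v y) + y \<bullet> (R *v v) = r \<bullet> y"
      by (simp add: v inner_commute)
    then have "(y + v) \<bullet> (R *v (y + v)) = y \<bullet> (R *v y) + r \<bullet> y + v \<bullet> (R *v v)"
      by (simp add: matrix_vector_right_distrib inner_add_left inner_add_right)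
    moreover have "0 \<le> (y + v) \<bullet> (R *v (y + v))"
      using pd unfolding pos_def_def by (cases "y + v = 0") (auto simp: less_imp_le)
    ultimately show ?thesis by simp
  qed
  then show ?thesis by blast
qed

lemma neg_inner_le_on_box:
  fixes c x b :: "real ^ 'n"
  assumes "0 \<le> x" and "x \<le> b"
  shows "- (c \<bullet> x) \<le> (\<Sum>i\<in>UNIV. \<bar>c $ i\<bar> * b $ i)"
proof -
  have "- (c $ i * x $ i) \<le> \<bar>c $ i\<bar> * b $ i" for i
  proof -
    have "0 \<le> x $ i" "x $ i \<le> b $ i"
      using assms by (auto simp: less_eq_vec_def)
    then have "\<bar>c $ i * x $ i\<bar> \<le> \<bar>c $ i\<bar> * b $ i"
      by (simp add: abs_mult mult_left_mono)
    then show ?thesis by linarith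
  qed
  then have "(\<Sum>i\<in>UNIV. - (c $ i * x $ i)) \<le> (\<Sum>i\<in>UNIV. \<bar>c $ i\<bar> * b $ i)"
    by (intro sum_mono)
  then show ?thesis by (simp add: inner_vec_def sum_negf)
qed

text \<open>The vector \<open>v\<close> is a primal point whose existence certifies that the finite bounds are
  nonnegative; \<open>\<theta>\<close> is the multiplier of these bounds.\<close>

lemma upper_bound_term_nonneg:
  fixes u :: "ereal ^ 'n" and v \<theta> :: "real ^ 'n"
  assumes "0 \<le> v" and "\<forall>i\<in>bounded_idx u. ereal (v $ i) \<le> u $ i" and "0 \<le> \<theta>"
  shows "0 \<le> (\<Sum>i\<in>bounded_idx u. real_of_ereal (u $ i) * \<theta> $ i)"
proof (rule sum_nonneg)
  fix i
  assume "i \<in> bounded_idx u"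
  then have "ereal (v $ i) \<le> u $ i" using assms by blast
  moreover have "0 \<le> v $ i" "0 \<le> \<theta> $ i"
    using assms by (auto simp: less_eq_vec_def)
  ultimately have "0 \<le> u $ i"
    by (meson ereal_less_eq(5) order_trans)
  then show "0 \<le> real_of_ereal (u $ i) * \<theta> $ i"
    using \<open>0 \<le> \<theta> $ i\<close> by (simp add: real_of_ereal_pos)
qed

theorem lemma4:
  fixes P :: "((real ^ 'z) \<times> (real ^ 'x)) set"
    and zbar cz :: "real ^ 'z" and xbar cx :: "real ^ 'x"
    and G0 :: "real ^ 'y ^ 'x" and H0 :: "real ^ 'w ^ 'x" and h0 :: "real ^ 'x"
    and G1 :: "real ^ 'y ^ 'm" and H1 :: "real ^ 'w ^ 'm" and h1 :: "real ^ 'm"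
    and ybar :: "ereal ^ 'y" and wbar :: "ereal ^ 'w"
    and R :: "real ^ 'y ^ 'y" and r :: "real ^ 'y"
  assumes "closed P" and "convex P"
    and "\<And>i. ybar $ i \<noteq> -\<infinity>" and "\<And>i. wbar $ i \<noteq> -\<infinity>"
    and "transpose R = R" and "pos_def R"
    and "\<And>z x. (z, x) \<in> leader_set P zbar xbar \<Longrightarrow>
           vi_solvable R r (follower_set G0 H0 h0 G1 H1 h1 ybar wbar x)"
    and "stack h0 h1 = 0"
  shows "dual_relax_value P zbar xbar cz cx (stack G0 G1) (stack H0 H1) (stack h0 h1)
           ybar wbar R r < \<infinity>"
proof -
  obtain B where B: "\<And>y. - (y \<bullet> (R *v y)) - r \<bullet> y \<le> B"
    using concave_quadratic_bounded_above[OF \<open>transpose R = R\<close> \<open>pos_def R\<close>] by blast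
  define C where
    "C = B + (\<Sum>i\<in>UNIV. \<bar>cx $ i\<bar> * xbar $ i) + (\<Sum>i\<in>UNIV. \<bar>cz $ i\<bar> * zbar $ i)"
  have "dual_relax_objective cz cx (stack h0 h1) ybar wbar R r s \<le> C"
    if s_feas: "s \<in> dual_relax_feasible P zbar xbar (stack G0 G1) (stack H0 H1) (stack h0 h1)
      ybar wbar R r" for s
  proof -
    obtain z x y w \<pi> \<mu>y \<mu>w \<theta>y \<theta>w where s: "s = (z, x, y, w, \<pi>, (\<mu>y, \<mu>w), \<theta>y, \<theta>w)"
      by (metis prod.exhaust)
    have box: "0 \<le> z" "z \<le> zbar" "0 \<le> x" "x \<le> xbar"
      and y: "0 \<le> y" "\<forall>i\<in>bounded_idx ybar. ereal (y $ i) \<le> ybar $ i" "0 \<le> \<theta>y"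
      and w: "0 \<le> w" "\<forall>i\<in>bounded_idx wbar. ereal (w $ i) \<le> wbar $ i" "0 \<le> \<theta>w"
      using s_feas unfolding s dual_relax_feasible_def leader_set_def by auto
    have "dual_relax_objective cz cx (stack h0 h1) ybar wbar R r s
        = - (y \<bullet> (R *v y)) - r \<bullet> y
          - (\<Sum>i\<in>bounded_idx wbar. real_of_ereal (wbar $ i) * \<theta>w $ i)
          - (\<Sum>i\<in>bounded_idx ybar. real_of_ereal (ybar $ i) * \<theta>y $ i)
          - cx \<bullet> x - cz \<bullet> z"
      unfolding s dual_relax_objective_def \<open>stack h0 h1 = 0\<close> by simp
    then show ?thesis
      using B[of y] upper_bound_term_nonneg[OF y] upper_bound_term_nonneg[OF w]
        neg_inner_le_on_box[OF box(1,2), of cz] neg_inner_le_on_box[OF box(3,4), of cx]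
      unfolding C_def by linarith
  qed
  then have "dual_relax_value P zbar xbar cz cx (stack G0 G1) (stack H0 H1) (stack h0 h1)
      ybar wbar R r \<le> ereal C"
    unfolding dual_relax_value_def by (intro SUP_least) simp
  also have "\<dots> < \<infinity>" by simp
  finally show ?thesis .
qed

end
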